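(* For every integer $n\ge 1$, $\mathrm{pf}_n(123,132,213)$ is equal to the number of rooted ordered trees with $n+1$ edges such that every vertex is either a leaf or adjacent to a leaf.
   Context: A Dyck path of semilength $n$ is a lattice path from $(0,0)$ to $(n,n)$ consisting of $n$ north steps $N=(0,1)$ and $n$ east steps $E=(1,0)$ that never goes below the line $y=x$. A parking function of size $n$ is a Dyck path of semilength $n$ whose $n$ north steps are labeled bijectively by $\{1,\dots,n\}$ so that whenever two north steps are consecutive in the path (one immediately following the other), the label of the later one is larger. For a parking function $p$ of size $n$, $\phi(p)$ is the permutation of $\{1,\dots,n\}$ (in one-line notation) obtained by reading the labels of the north steps in the order they occur along the path. A permutation $\pi$ of $\{1,\dots,n\}$ contains a permutation $\rho$ of $\{1,\dots,m\}$ if there are indices $1\le i_1<\cdots<i_m\le n$ such that $\pi_{i_a}\le\pi_{i_b}$ if and only if $\rho_a\le\rho_b$; otherwise $\pi$ avoids $\rho$. For permutations $\rho_1,\dots,\rho_r$, $\mathrm{pf}_n(\rho_1,\dots,\rho_r)$ denotes the number of parking functions $p$ of size $n$ such that $\phi(p)$ avoids each of $\rho_1,\dots,\rho_r$. A rooted ordered tree is a finite unlabeled rooted tree in which the children of each vertex are linearly ordered (a plane tree). A leaf is a vertex with no children (so the root of a tree with at least one edge is never a leaf, even if it has degree one). Two vertices are adjacent if they are joined by an edge. *)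

theory Defs
  imports Main
begin

datatype step = North | East

text \<open>
  After \<open>k\<close> steps a path \<open>d\<close> from the origin is at the point
  \<open>(count_list (take k d) East, count_list (take k d) North)\<close>.
\<close>

definition dyck_path :: "nat \<Rightarrow> step list \<Rightarrow> bool" where
  "dyck_path n d \<longleftrightarrow>
     count_list d North = n \<and> count_list d East = n \<and>
     (\<forall>k\<le>length d. count_list (take k d) East \<le> count_list (take k d) North)"

definition is_perm :: "nat \<Rightarrow> nat list \<Rightarrow> bool" where
  "is_perm n w \<longleftrightarrow> distinct w \<and> set w = {1..n}"

definition contains_pattern :: "nat list \<Rightarrow> nat list \<Rightarrow> bool" where
  "contains_pattern w \<rho> \<longleftrightarrow>
     (\<exists>f :: nat \<Rightarrow> nat. strict_mono_on {..<length \<rho>} f \<and>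
        (\<forall>a<length \<rho>. f a < length w) \<and>
        (\<forall>a<length \<rho>. \<forall>b<length \<rho>. w ! f a \<le> w ! f b \<longleftrightarrow> \<rho> ! a \<le> \<rho> ! b))"

definition avoids_pattern :: "nat list \<Rightarrow> nat list \<Rightarrow> bool" where
  "avoids_pattern w \<rho> \<longleftrightarrow> \<not> contains_pattern w \<rho>"

text \<open>A parking function is a Dyck path whose north steps carry their labels.\<close>

datatype labelled_step = LNorth nat | LEast

fun unlabel :: "labelled_step \<Rightarrow> step" where
  "unlabel (LNorth a) = North"
| "unlabel LEast = East"

fun reading_word :: "labelled_step list \<Rightarrow> nat list" where
  "reading_word [] = []"
| "reading_word (LNorth a # p) = a # reading_word p"
| "reading_word (LEast # p) = reading_word p"

definition parking_function :: "nat \<Rightarrow> labelled_step list \<Rightarrow> bool" where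
  "parking_function n p \<longleftrightarrow>
     dyck_path n (map unlabel p) \<and> is_perm n (reading_word p) \<and>
     (\<forall>i a b. Suc i < length p \<and> p ! i = LNorth a \<and> p ! Suc i = LNorth b \<longrightarrow> a < b)"

definition pf :: "nat \<Rightarrow> nat list set \<Rightarrow> nat" where
  "pf n R = card {p. parking_function n p \<and> (\<forall>\<rho>\<in>R. avoids_pattern (reading_word p) \<rho>)}"

datatype plane_tree = Node (children: "plane_tree list")

text \<open>
  A vertex is represented by its address: the list of child indices (starting
  from 0) along the path from the root, so that the root is \<open>[]\<close> and the children
  of \<open>v\<close> are the vertices of the form \<open>v @ [i]\<close>.
\<close>

fun is_vertex :: "plane_tree \<Rightarrow> nat list \<Rightarrow> bool" where
  "is_vertex t [] \<longleftrightarrow> True"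
| "is_vertex t (i # v) \<longleftrightarrow> i < length (children t) \<and> is_vertex (children t ! i) v"

definition is_leaf :: "plane_tree \<Rightarrow> nat list \<Rightarrow> bool" where
  "is_leaf t v \<longleftrightarrow> is_vertex t v \<and> (\<forall>i. \<not> is_vertex t (v @ [i]))"

definition adjacent :: "plane_tree \<Rightarrow> nat list \<Rightarrow> nat list \<Rightarrow> bool" where
  "adjacent t u v \<longleftrightarrow>
     is_vertex t u \<and> is_vertex t v \<and> (\<exists>i. v = u @ [i] \<or> u = v @ [i])"

definition edges :: "plane_tree \<Rightarrow> nat list set set" where
  "edges t = {{u, v} | u v. adjacent t u v}"

end

theory Submission imports Defs begin

text \<open>
  A permutation avoids the three patterns iff entries at distance at least 2 decrease, so it
  is a concatenation of blocks of size 1 or 2, where the blocks go down and a block of size 2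
  goes up. Cutting a parking function before each block gives a word whose letters change the
  height by \<open>1 - m\<close>, with \<open>m \<ge> 0\<close>. There is one block of size 1 for each \<open>m \<ge> 1\<close>, and
  there are \<open>m + 1\<close> blocks of size 2 for each \<open>m\<close>.

  On the other side, write the root of a tree without protected vertices as \<open>A @ Leaf # B\<close>
  with no leaf in \<open>A\<close>. If \<open>B\<close> contains no leaf, the root is a composition of the \<open>m\<close> trees in
  \<open>A @ B\<close> (in \<open>m + 1\<close> ways); otherwise \<open>Node B\<close> is again such a tree, and the root is a
  composition of the \<open>m\<close> trees in \<open>A @ [Node B]\<close>. So these trees and the block words are both
  described by the same Lukasiewicz words, read in postfix order.
\<close>

section \<open>Trees\<close>

fun num_vertices :: "plane_tree \<Rightarrow> nat" where
  "num_vertices (Node ts) = Suc (sum_list (map num_vertices ts))"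

abbreviation Leaf :: plane_tree where
  "Leaf \<equiv> Node []"

fun leafy :: "plane_tree \<Rightarrow> bool" where
  "leafy (Node ts) \<longleftrightarrow> (ts = [] \<or> Leaf \<in> set ts) \<and> (\<forall>t\<in>set ts. leafy t)"

lemma vertices_Node:
  "{v. is_vertex (Node ts) v} =
     insert [] (\<Union>i<length ts. (#) i ` {v. is_vertex (ts ! i) v})"
proof (rule set_eqI)
  fix v show "v \<in> {v. is_vertex (Node ts) v} \<longleftrightarrow>
    v \<in> insert [] (\<Union>i<length ts. (#) i ` {v. is_vertex (ts ! i) v})"
    by (cases v) auto
qed

lemma finite_card_vertices:
  "finite {v. is_vertex t v} \<and> card {v. is_vertex t v} = num_vertices t"
proof (induction t)
  case (Node ts)
  have fin: "finite {v. is_vertex (ts ! i) v}"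
    and card: "card {v. is_vertex (ts ! i) v} = num_vertices (ts ! i)"
    if "i < length ts" for i
    using Node.IH[of "ts ! i"] that by auto
  have "card (\<Union>i<length ts. (#) i ` {v. is_vertex (ts ! i) v})
      = (\<Sum>i<length ts. card ((#) i ` {v. is_vertex (ts ! i) v}))"
    by (rule card_UN_disjoint) (auto simp: fin)
  also have "\<dots> = (\<Sum>i<length ts. num_vertices (ts ! i))"
    by (rule sum.cong) (auto simp: card card_image)
  also have "\<dots> = sum_list (map num_vertices ts)"
    by (simp add: sum_list_sum_nth atLeast0LessThan)
  finally have "card (\<Union>i<length ts. (#) i ` {v. is_vertex (ts ! i) v})
      = sum_list (map num_vertices ts)" .
  moreover have "finite (\<Union>i<length ts. (#) i ` {v. is_vertex (ts ! i) v})"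
    by (auto simp: fin)
  moreover have "[] \<notin> (\<Union>i<length ts. (#) i ` {v. is_vertex (ts ! i) v})"
    by auto
  ultimately show ?case
    unfolding vertices_Node by simp
qed

lemma is_vertex_append1: "is_vertex t (v @ w) \<Longrightarrow> is_vertex t v"
  by (induction t v rule: is_vertex.induct) auto

text \<open>An edge joins a vertex other than the root to its parent, whose address is given by
  \<open>butlast\<close>.\<close>

lemma edges_eq: "edges t = (\<lambda>v. {butlast v, v}) ` ({v. is_vertex t v} - {[]})"
proof (intro set_eqI iffI)
  fix e assume "e \<in> edges t"
  then obtain u v where e: "e = {u, v}" and uv: "adjacent t u v"
    unfolding edges_def by auto
  from uv obtain i where "v = u @ [i] \<or> u = v @ [i]" and "is_vertex t u" "is_vertex t v"
    unfolding adjacent_def by auto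
  then obtain w where "is_vertex t (w @ [i])" "e = {w, w @ [i]}"
    unfolding e by blast
  then show "e \<in> (\<lambda>v. {butlast v, v}) ` ({v. is_vertex t v} - {[]})"
    by (intro image_eqI[of _ _ "w @ [i]"]) auto
next
  fix e assume "e \<in> (\<lambda>v. {butlast v, v}) ` ({v. is_vertex t v} - {[]})"
  then obtain v where v: "is_vertex t v" "v \<noteq> []" and e: "e = {butlast v, v}"
    by auto
  then have vb: "v = butlast v @ [last v]"
    by simp
  then have "is_vertex t (butlast v)"
    using v(1) is_vertex_append1 by metis
  then have "adjacent t (butlast v) v"
    using v vb unfolding adjacent_def by blast
  then show "e \<in> edges t"
    unfolding e edges_def by blast
qed

text \<open>Edges are indexed injectively by their lower endpoints: two nonempty addresses cannot
  each be the \<open>butlast\<close> of the other. Only the root is left over.\<close>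

lemma card_edges: "Suc (card (edges t)) = num_vertices t"
proof -
  have "inj_on (\<lambda>v. {butlast v, v}) ({v. is_vertex t v} - {[]})"
  proof (rule inj_onI)
    fix u v :: "nat list"
    assume "u \<in> {v. is_vertex t v} - {[]}" "v \<in> {v. is_vertex t v} - {[]}"
      and eq: "{butlast u, u} = {butlast v, v}"
    then have ne: "u \<noteq> []" "v \<noteq> []" by auto
    show "u = v"
    proof (rule ccontr)
      assume "u \<noteq> v"
      with eq have "butlast u = v" "butlast v = u"
        by (auto simp: doubleton_eq_iff)
      then have "length u - 1 = length v" "length v - 1 = length u"
        by (metis length_butlast)+
      then show False using ne by (cases u; cases v) auto
    qed
  qed
  then have "card (edges t) = card ({v. is_vertex t v} - {[]})"
    unfolding edges_eq by (rule card_image)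
  moreover have "[] \<in> {v. is_vertex t v}" by simp
  ultimately show ?thesis
    using finite_card_vertices[of t] by (metis card_Suc_Diff1)
qed

section \<open>The leaf condition as a recursion on trees\<close>

lemma is_leaf_Nil: "is_leaf (Node ts) [] \<longleftrightarrow> ts = []"
  by (auto simp: is_leaf_def)

lemma is_leaf_Cons:
  "is_leaf (Node ts) (i # v) \<longleftrightarrow> i < length ts \<and> is_leaf (ts ! i) v"
  by (auto simp: is_leaf_def)

lemma leafy_iff_child:
  "leafy t \<longleftrightarrow>
     (\<forall>v. is_vertex t v \<longrightarrow> is_leaf t v \<or> (\<exists>i. is_leaf t (v @ [i])))"
proof (induction t)
  case (Node ts)
  have root: "Leaf \<in> set ts \<longleftrightarrow> (\<exists>i. is_leaf (Node ts) [i])"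
  proof -
    have "is_leaf s [] \<longleftrightarrow> s = Leaf" for s
      by (cases s) (simp add: is_leaf_Nil)
    then show ?thesis
      by (auto simp: is_leaf_Cons in_set_conv_nth)
  qed
  \<comment> \<open>Addresses \<open>[]\<close> carry the condition at the root, addresses
    \<open>i # v\<close> the condition in the \<open>i\<close>-th subtree.\<close>
  have all_split: "(\<forall>v. P v) \<longleftrightarrow> P [] \<and> (\<forall>i v. P (i # v))" for P :: "nat list \<Rightarrow> bool"
    by (metis neq_Nil_conv)
  have "(\<forall>t\<in>set ts. leafy t) \<longleftrightarrow> (\<forall>i<length ts. \<forall>v. is_vertex (ts ! i) v \<longrightarrow>
      is_leaf (ts ! i) v \<or> (\<exists>j. is_leaf (ts ! i) (v @ [j])))"
    using Node.IH by (simp add: all_set_conv_all_nth)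
  then show ?case
    unfolding leafy.simps root
    by (subst all_split) (auto simp: is_leaf_Nil is_leaf_Cons)
qed

text \<open>A parent has a child and so is no leaf; hence a leaf adjacent to a vertex is one of its
  children.\<close>

lemma leafy_iff:
  "leafy t \<longleftrightarrow>
     (\<forall>v. is_vertex t v \<longrightarrow> is_leaf t v \<or> (\<exists>u. is_leaf t u \<and> adjacent t v u))"
proof -
  have "(\<exists>u. is_leaf t u \<and> adjacent t v u) \<longleftrightarrow> (\<exists>i. is_leaf t (v @ [i]))"
    if "is_vertex t v" for v
    using that unfolding adjacent_def is_leaf_def by blast
  then show ?thesis
    unfolding leafy_iff_child by blast
qed

section \<open>Block words and trees\<close>

text \<open>
  \<open>Single k\<close> stands for the steps \<open>N E\<^sup>k\<^sup>+\<^sup>1\<close> and \<open>Double j k\<close> for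
  \<open>N E\<^sup>j N E\<^sup>k\<^sup>+\<^sup>1\<close>, where the two labels of a \<open>Double\<close> increase and labels decrease
  from one block to the next.
\<close>

datatype block = Single nat | Double nat nat

fun block_size :: "block \<Rightarrow> nat" where
  "block_size (Single k) = 1"
| "block_size (Double j k) = 2"

abbreviation word_size :: "block list \<Rightarrow> nat" where
  "word_size v \<equiv> sum_list (map block_size v)"

text \<open>
  Heights only have to be checked at the ends of blocks: since a block ends in an east
  step, the height after the first run of east steps of a \<open>Double\<close> is at least the final one.
\<close>

fun descends_from :: "nat \<Rightarrow> block list \<Rightarrow> bool" where
  "descends_from h [] \<longleftrightarrow> h = 0"
| "descends_from h (Single k # v) \<longleftrightarrow> k \<le> h \<and> descends_from (h - k) v"
| "descends_from h (Double j k # v) \<longleftrightarrow> j + k \<le> Suc h \<and> descends_from (Suc h - (j + k)) v"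

text \<open>Here the word is read from right to left.\<close>

fun ascends_to :: "nat \<Rightarrow> block list \<Rightarrow> bool" where
  "ascends_to h [] \<longleftrightarrow> h = 0"
| "ascends_to h (Single k # w) \<longleftrightarrow> ascends_to (h + k) w"
| "ascends_to h (Double j k # w) \<longleftrightarrow> 0 < h + j + k \<and> ascends_to (h + j + k - 1) w"

text \<open>There is one height \<open>h\<close> at the cut between \<open>rev u\<close> and
  \<open>v\<close>. The induction, for arbitrary \<open>v\<close>, moves a block across the cut: a
  block ending at \<open>h\<close> starts at \<open>h + k\<close> or at
  \<open>h + j + k - 1\<close>.\<close>

lemma descends_from_rev_append:
  "descends_from 0 (rev u @ v) \<longleftrightarrow> (\<exists>h. ascends_to h u \<and> descends_from h v)"
proof (induction u arbitrary: v)
  case Nil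
  then show ?case by simp
next
  case (Cons b u)
  have "descends_from 0 (rev (b # u) @ v) \<longleftrightarrow>
      (\<exists>h. ascends_to h u \<and> descends_from h (b # v))"
    using Cons.IH[of "b # v"] by simp
  also have "\<dots> \<longleftrightarrow> (\<exists>h. ascends_to h (b # u) \<and> descends_from h v)"
  proof (cases b)
    case (Single k)
    show ?thesis
    proof
      assume "\<exists>h. ascends_to h u \<and> descends_from h (b # v)"
      then obtain h where "ascends_to h u" "k \<le> h" "descends_from (h - k) v"
        by (auto simp: Single)
      then have "ascends_to (h - k) (b # u) \<and> descends_from (h - k) v"
        by (simp add: Single)
      then show "\<exists>h. ascends_to h (b # u) \<and> descends_from h v" ..
    next
      assume "\<exists>h. ascends_to h (b # u) \<and> descends_from h v"
      then obtain h where "ascends_to (h + k) u" "descends_from h v"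
        by (auto simp: Single)
      then have "ascends_to (h + k) u \<and> descends_from (h + k) (b # v)"
        by (simp add: Single)
      then show "\<exists>h. ascends_to h u \<and> descends_from h (b # v)" ..
    qed
  next
    case (Double j k)
    show ?thesis
    proof
      assume "\<exists>h. ascends_to h u \<and> descends_from h (b # v)"
      then obtain h where "ascends_to h u" "j + k \<le> Suc h" "descends_from (Suc h - (j + k)) v"
        by (auto simp: Double)
      then have "ascends_to (Suc h - (j + k)) (b # u) \<and> descends_from (Suc h - (j + k)) v"
        by (simp add: Double)
      then show "\<exists>h. ascends_to h (b # u) \<and> descends_from h v" ..
    next
      assume "\<exists>h. ascends_to h (b # u) \<and> descends_from h v"
      then obtain h where *: "0 < h + j + k" "ascends_to (h + j + k - 1) u" "descends_from h v"
        by (auto simp: Double)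
      \<comment> \<open>Positivity makes the truncated subtraction exact.\<close>
      then have "Suc (h + j + k - 1) - (j + k) = h" by simp
      with * have "ascends_to (h + j + k - 1) u \<and> descends_from (h + j + k - 1) (b # v)"
        by (simp add: Double)
      then show "\<exists>h. ascends_to h u \<and> descends_from h (b # v)" ..
    qed
  qed
  finally show ?case .
qed

lemma descends_from_rev: "descends_from 0 (rev u) \<longleftrightarrow> ascends_to 0 u"
  using descends_from_rev_append[of u "[]"] by simp

text \<open>
  A stack machine running through the word from right to left; a stack of \<open>h + 1\<close> trees
  corresponds to height \<open>h\<close>. Every block pops some trees and pushes a single one, whose
  root has exactly one leaf child for a \<open>Double\<close> and several for a \<open>Single\<close>.
\<close>

fun stack_of :: "block list \<Rightarrow> plane_tree list" where
  "stack_of [] = [Node [Leaf]]"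
| "stack_of (Single k # w) =
     (let ts = stack_of w
      in Node (take k ts @ Leaf # children (ts ! k)) # drop (Suc k) ts)"
| "stack_of (Double j k # w) =
     (let ts = stack_of w
      in Node (take j ts @ Leaf # take k (drop j ts)) # drop (j + k) ts)"

section \<open>Invariants of the stack machine\<close>

abbreviation total_vertices :: "plane_tree list \<Rightarrow> nat" where
  "total_vertices ts \<equiv> sum_list (map num_vertices ts)"

definition leafy_stack :: "plane_tree list \<Rightarrow> bool" where
  "leafy_stack ts \<longleftrightarrow> (\<forall>t\<in>set ts. leafy t \<and> t \<noteq> Leaf)"

lemma leafy_stack_simps [simp]:
  "leafy_stack []"
  "leafy_stack (t # ts) \<longleftrightarrow> leafy t \<and> t \<noteq> Leaf \<and> leafy_stack ts"
  "leafy_stack (ss @ ts) \<longleftrightarrow> leafy_stack ss \<and> leafy_stack ts"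
  by (auto simp: leafy_stack_def)

lemma leafy_stackD: "leafy_stack ts \<Longrightarrow> Leaf \<notin> set ts"
  by (auto simp: leafy_stack_def)

lemma stack_of_Single:
  assumes "stack_of w = A @ Node cs # ts"
  shows "stack_of (Single (length A) # w) = Node (A @ Leaf # cs) # ts"
  using assms by (simp add: nth_append)

lemma stack_of_Double:
  assumes "stack_of w = A @ B @ ts"
  shows "stack_of (Double (length A) (length B) # w) = Node (A @ Leaf # B) # ts"
  using assms by simp

lemma split_at:
  assumes "k < length ts"
  obtains A t B where "ts = A @ t # B" "length A = k"
  using assms id_take_nth_drop[of k ts] by (metis length_take min.absorb4)

lemma split_at2:
  assumes "j + k \<le> length ts"
  obtains A B C where "ts = A @ B @ C" "length A = j" "length B = k"
proof
  show "ts = take j ts @ take k (drop j ts) @ drop k (drop j ts)"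
    by (metis append_take_drop_id)
  show "length (take j ts) = j" "length (take k (drop j ts)) = k"
    using assms by auto
qed

text \<open>The machine starts with one tree of two vertices. A \<open>Single\<close> reuses the
  root of the last popped tree and adds only a leaf; a \<open>Double\<close> adds a root and a leaf.
  So the vertex count grows by the block size, and the heights guarantee enough trees to
  pop.\<close>

lemma stack_of_props:
  assumes "ascends_to h w"
  shows "length (stack_of w) = Suc h \<and> leafy_stack (stack_of w) \<and>
    total_vertices (stack_of w) = word_size w + 2"
  using assms
proof (induction w arbitrary: h)
  case Nil
  then show ?case by simp
next
  case (Cons b w)
  show ?case
  proof (cases b)
    case (Single k)
    have IH: "length (stack_of w) = Suc (h + k)" "leafy_stack (stack_of w)"
      "total_vertices (stack_of w) = word_size w + 2"
      using Cons.IH[of "h + k"] Cons.prems by (auto simp: Single)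
    then obtain A t ts where s: "stack_of w = A @ t # ts" and A: "length A = k"
      by (metis split_at less_add_Suc2)
    obtain cs where t: "t = Node cs" by (cases t)
    have "stack_of (b # w) = Node (A @ Leaf # cs) # ts"
      unfolding Single A[symmetric] by (rule stack_of_Single) (simp add: s t)
    then show ?thesis
      using IH A by (auto simp: s t leafy_stack_def Single)
  next
    case (Double j k)
    have h: "0 < h + j + k" using Cons.prems by (simp add: Double)
    have IH: "length (stack_of w) = h + j + k" "leafy_stack (stack_of w)"
      "total_vertices (stack_of w) = word_size w + 2"
      using Cons.IH[of "h + j + k - 1"] Cons.prems by (auto simp: Double)
    have "j + k \<le> length (stack_of w)" using IH by simp
    then obtain A B ts where s: "stack_of w = A @ B @ ts"
      and AB: "length A = j" "length B = k"
      by (rule split_at2)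
    have "stack_of (b # w) = Node (A @ Leaf # B) # ts"
      unfolding Double AB[symmetric] by (rule stack_of_Double) (simp add: s)
    then show ?thesis
      using IH AB by (auto simp: s leafy_stack_def Double)
  qed
qed

text \<open>No tree on the stack is \<open>Leaf\<close>, so the inserted leaf is the first leaf
  child of the new root. After a \<open>Single\<close>, \<open>cs\<close> contains a further leaf,
  because \<open>Node cs\<close> was leafy and not \<open>Leaf\<close>; after a
  \<open>Double\<close> there is none.\<close>

lemma stack_of_Cons_cases:
  assumes "ascends_to h (b # w)"
  obtains (Single) A cs ts where "b = Single (length A)" "stack_of w = A @ Node cs # ts"
      "stack_of (b # w) = Node (A @ Leaf # cs) # ts" "Leaf \<in> set cs" "Leaf \<notin> set A"
      "ascends_to (h + length A) w"
  | (Double) A B ts where "b = Double (length A) (length B)" "stack_of w = A @ B @ ts"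
      "stack_of (b # w) = Node (A @ Leaf # B) # ts" "Leaf \<notin> set A" "Leaf \<notin> set B"
      "A @ B @ ts \<noteq> []" "ascends_to (h + length A + length B - 1) w"
proof (cases b)
  case b: (Single k)
  have w: "ascends_to (h + k) w" using assms by (simp add: b)
  note IH = stack_of_props[OF w]
  then obtain A t ts where s: "stack_of w = A @ t # ts" and A: "length A = k"
    by (metis split_at less_add_Suc2)
  obtain cs where t: "t = Node cs" by (cases t)
  show ?thesis
    using that(1)[of A cs ts] IH w A stack_of_Single[of w A cs ts]
    by (auto simp: s t b leafy_stack_def)
next
  case b: (Double j k)
  have w: "ascends_to (h + j + k - 1) w" and h: "0 < h + j + k" using assms by (auto simp: b)
  note IH = stack_of_props[OF w]
  then have "j + k \<le> length (stack_of w)" using h by simp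
  then obtain A B ts where s: "stack_of w = A @ B @ ts"
    and AB: "length A = j" "length B = k"
    by (rule split_at2)
  have "stack_of (b # w) = Node (A @ Leaf # B) # ts"
    unfolding b AB[symmetric] by (rule stack_of_Double) (simp add: s)
  moreover have "A @ B @ ts \<noteq> []" using IH s by auto
  ultimately show ?thesis
    using that(2)[of A B ts] IH w AB s leafy_stackD by (auto simp: b)
qed

section \<open>Inverting the stack machine\<close>

lemma first_occurrence_unique:
  assumes "A @ x # B = C @ x # D" "x \<notin> set A" "x \<notin> set C"
  shows "A = C \<and> B = D"
  using assms
proof (induction A arbitrary: C)
  case Nil
  then show ?case by (cases C) auto
next
  case (Cons a A)
  then show ?case by (cases C) auto
qed

text \<open>The top tree reveals the last block: a second leaf child tells \<open>Single\<close>
  from \<open>Double\<close>, and the position of the first one gives the arguments. Undoing the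
  block recovers the previous stack.\<close>

lemma stack_of_inj:
  assumes "ascends_to h w" "ascends_to h' w'" "stack_of w = stack_of w'"
  shows "w = w'"
  using assms
proof (induction w arbitrary: h h' w')
  case Nil
  show ?case
  proof (cases w')
    case (Cons b v)
    \<comment> \<open>No block produces \<open>[Node [Leaf]]\<close>: a \<open>Single\<close> would
      need a second leaf child, a \<open>Double\<close> an empty stack before it.\<close>
    have "ascends_to h' (b # v)" using Nil Cons by simp
    then show ?thesis
      by (cases rule: stack_of_Cons_cases)
        (use Nil.prems(3) Cons in \<open>auto simp: Cons_eq_append_conv simp del: stack_of.simps(2,3)\<close>)
  qed simp
next
  case (Cons b w)
  note simps = stack_of.simps(2,3)
  from Cons.prems(1) show ?case
  proof (cases rule: stack_of_Cons_cases)
    case 1: (Single A cs ts)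
    show ?thesis
    proof (cases w')
      case Nil
      then show ?thesis using Cons.prems(3) 1 by (auto simp: Cons_eq_append_conv simp del: simps)
    next
      case w': (Cons b' v)
      have "ascends_to h' (b' # v)" using Cons.prems w' by simp
      then show ?thesis
      proof (cases rule: stack_of_Cons_cases)
        case 2: (Single A' cs' ts')
        have "A @ Leaf # cs = A' @ Leaf # cs'" and ts: "ts = ts'"
          using Cons.prems(3) 1 2 w' by (auto simp del: simps)
        then have "A = A'" "cs = cs'"
          using first_occurrence_unique 1 2 by metis+
        then show ?thesis
          using Cons.IH[of "h + length A" "h' + length A'" v] 1 2 ts w' by simp
      next
        case 2: (Double A' B' ts')
        have "A @ Leaf # cs = A' @ Leaf # B'"
          using Cons.prems(3) 1 2 w' by (auto simp del: simps)
        \<comment> \<open>Impossible, since \<open>cs\<close> contains a leaf and \<open>B'\<close>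
          does not.\<close>
        then have "cs = B'"
          using first_occurrence_unique 1 2 by metis
        then show ?thesis using 1 2 by simp
      qed
    qed
  next
    case 1: (Double A B ts)
    show ?thesis
    proof (cases w')
      case Nil
      then show ?thesis using Cons.prems(3) 1 by (auto simp: Cons_eq_append_conv simp del: simps)
    next
      case w': (Cons b' v)
      have "ascends_to h' (b' # v)" using Cons.prems w' by simp
      then show ?thesis
      proof (cases rule: stack_of_Cons_cases)
        case 2: (Single A' cs' ts')
        have "A @ Leaf # B = A' @ Leaf # cs'"
          using Cons.prems(3) 1 2 w' by (auto simp del: simps)
        then have "B = cs'"
          using first_occurrence_unique 1 2 by metis
        then show ?thesis using 1 2 by simp
      next
        case 2: (Double A' B' ts')
        have "A @ Leaf # B = A' @ Leaf # B'" and ts: "ts = ts'"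
          using Cons.prems(3) 1 2 w' by (auto simp del: simps)
        then have "A = A'" "B = B'"
          using first_occurrence_unique 1 2 by metis+
        then show ?thesis
          using Cons.IH[of "h + length A + length B - 1" "h' + length A' + length B' - 1" v]
            1 2 ts w' by simp
      qed
    qed
  qed
qed

text \<open>The machine is run backwards: each undone block lowers the total number of vertices,
  until the initial stack is reached.\<close>

lemma stack_of_surj:
  assumes "leafy_stack ts" "length ts = Suc h"
  shows "\<exists>w. ascends_to h w \<and> stack_of w = ts"
  using assms
proof (induction "total_vertices ts" arbitrary: ts h rule: less_induct)
  case less
  then obtain t rest where ts: "ts = t # rest" and rest: "length rest = h"
    by (cases ts) auto
  obtain cs where t: "t = Node cs" by (cases t)
  have cs: "Leaf \<in> set cs" "\<forall>t\<in>set cs. leafy t"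
    using less.prems by (auto simp: ts t)
  obtain A B where AB: "cs = A @ Leaf # B" "Leaf \<notin> set A"
    using split_list_first[OF cs(1)] by blast
  have A: "leafy_stack A"
    using cs AB by (auto simp: leafy_stack_def)
  show ?case
  proof (cases "Leaf \<in> set B")
    case True
    \<comment> \<open>Without its first leaf the root still has a leaf child, so
      \<open>Node B\<close> may stay on the stack.\<close>
    let ?us = "A @ Node B # rest"
    have "leafy_stack ?us"
      using less.prems A True cs by (auto simp: ts AB)
    moreover have "length ?us = Suc (h + length A)"
      using rest by simp
    moreover have "total_vertices ?us < total_vertices ts"
      by (simp add: ts t AB)
    ultimately obtain w where w: "ascends_to (h + length A) w" "stack_of w = ?us"
      using less.hyps by blast
    have "stack_of (Single (length A) # w) = ts"
      using stack_of_Single[OF w(2)] by (simp add: ts t AB)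
    moreover have "ascends_to h (Single (length A) # w)"
      using w by simp
    ultimately show ?thesis by blast
  next
    case False
    then have B: "leafy_stack B"
      using cs AB by (auto simp: leafy_stack_def)
    show ?thesis
    proof (cases "A @ B @ rest = []")
      \<comment> \<open>With nothing to pop, the stack is \<open>[Node [Leaf]]\<close>, the initial
        one.\<close>
      case True
      then have "ascends_to h [] \<and> stack_of [] = ts"
        using rest by (simp add: ts t AB)
      then show ?thesis ..
    next
      case False
      let ?us = "A @ B @ rest"
      have pos: "0 < h + length A + length B"
        using False rest by auto
      have "leafy_stack ?us"
        using less.prems A B by (auto simp: ts)
      moreover have "length ?us = Suc (h + length A + length B - 1)"
        using rest pos by simp
      moreover have "total_vertices ?us < total_vertices ts"
        by (simp add: ts t AB)
      ultimately obtain w where w: "ascends_to (h + length A + length B - 1) w" "stack_of w = ?us"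
        using less.hyps by blast
      have "stack_of (Double (length A) (length B) # w) = ts"
        using stack_of_Double[OF w(2)] by (simp add: ts t AB)
      moreover have "ascends_to h (Double (length A) (length B) # w)"
        using w pos by simp
      ultimately show ?thesis by blast
    qed
  qed
qed

text \<open>At height 0 the stack is a single tree, so \<open>hd\<close> loses nothing. The summand
  2 counts the vertices of the initial tree.\<close>

lemma bij_betw_words_trees:
  "bij_betw (\<lambda>v. hd (stack_of (rev v))) {v. descends_from 0 v \<and> word_size v = n}
     {t. leafy t \<and> num_vertices t = n + 2}"
proof (rule bij_betw_imageI)
  let ?V = "{v. descends_from 0 v \<and> word_size v = n}"
  let ?T = "{t. leafy t \<and> num_vertices t = n + 2}"
  have desc: "descends_from 0 v \<longleftrightarrow> ascends_to 0 (rev v)" for v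
    using descends_from_rev[of "rev v"] by simp
  have stack: "\<exists>t. stack_of (rev v) = [t] \<and> t \<in> ?T" if "v \<in> ?V" for v
  proof -
    have *: "ascends_to 0 (rev v)" "word_size v = n" using that desc by auto
    have "length (stack_of (rev v)) = Suc 0" and "leafy_stack (stack_of (rev v))"
      and "total_vertices (stack_of (rev v)) = n + 2"
      using stack_of_props[OF *(1)] *(2) by (auto simp: rev_map[symmetric])
    then show ?thesis by (auto simp: length_Suc_conv)
  qed
  show "inj_on (\<lambda>v. hd (stack_of (rev v))) ?V"
  proof (rule inj_onI)
    fix u v assume uv: "u \<in> ?V" "v \<in> ?V" and "hd (stack_of (rev u)) = hd (stack_of (rev v))"
    then have "stack_of (rev u) = stack_of (rev v)"
      using stack[OF uv(1)] stack[OF uv(2)] by auto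
    then have "rev u = rev v"
      using uv desc stack_of_inj[of 0 "rev u" 0 "rev v"] by simp
    then show "u = v" by simp
  qed
  show "(\<lambda>v. hd (stack_of (rev v))) ` ?V = ?T"
  proof (intro set_eqI iffI)
    fix t assume "t \<in> (\<lambda>v. hd (stack_of (rev v))) ` ?V"
    then show "t \<in> ?T" using stack by force
  next
    fix t assume t: "t \<in> ?T"
    \<comment> \<open>Having at least two vertices, \<open>t\<close> differs from
      \<open>Leaf\<close>.\<close>
    then have "leafy_stack [t]" by auto
    then obtain w where w: "ascends_to 0 w" "stack_of w = [t]"
      using stack_of_surj[of "[t]" 0] by auto
    then have "word_size w = n"
      using stack_of_props[OF w(1)] t by simp
    then have "rev w \<in> ?V"
      using w by (simp add: descends_from_rev rev_map[symmetric])
    then show "t \<in> (\<lambda>v. hd (stack_of (rev v))) ` ?V"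
      using w by (intro image_eqI[of _ _ "rev w"]) auto
  qed
qed

section \<open>Parking functions and block words\<close>

definition far_decreasing :: "nat list \<Rightarrow> bool" where
  "far_decreasing w \<longleftrightarrow> (\<forall>i j. i + 2 \<le> j \<and> j < length w \<longrightarrow> w ! j < w ! i)"

lemma far_decreasing_Nil [simp]: "far_decreasing []"
  by (simp add: far_decreasing_def)

text \<open>The new pairs join position 0 to positions from 2 on, which are those of
  \<open>tl w\<close>.\<close>

lemma far_decreasing_Cons [simp]:
  "far_decreasing (a # w) \<longleftrightarrow> (\<forall>x\<in>set (tl w). x < a) \<and> far_decreasing w"
proof (intro iffI conjI)
  assume L: "far_decreasing (a # w)"
  show "\<forall>x\<in>set (tl w). x < a"
  proof
    fix x assume "x \<in> set (tl w)"
    then obtain i where "i < length (tl w)" "x = tl w ! i"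
      by (auto simp: in_set_conv_nth)
    then show "x < a"
      using L[unfolded far_decreasing_def, rule_format, of 0 "Suc (Suc i)"]
      by (simp add: nth_tl)
  qed
  show "far_decreasing w"
    unfolding far_decreasing_def
  proof (intro allI impI)
    fix i j assume "i + 2 \<le> j \<and> j < length w"
    then show "w ! j < w ! i"
      using L[unfolded far_decreasing_def, rule_format, of "Suc i" "Suc j"] by simp
  qed
next
  assume R: "(\<forall>x\<in>set (tl w). x < a) \<and> far_decreasing w"
  show "far_decreasing (a # w)"
    unfolding far_decreasing_def
  proof (intro allI impI)
    fix i j assume ij: "i + 2 \<le> j \<and> j < length (a # w)"
    then obtain j' where j: "j = Suc (Suc j')"
      by (metis add_2_eq_Suc' Suc_le_D Suc_le_mono)
    show "(a # w) ! j < (a # w) ! i"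
    proof (cases i)
      case 0
      have "tl w ! j' \<in> set (tl w)" using ij j by (intro nth_mem) auto
      then show ?thesis using R ij j 0 by (simp add: nth_tl)
    next
      case (Suc i')
      then show ?thesis using R ij j unfolding far_decreasing_def by auto
    qed
  qed
qed

lemma contains_pattern3:
  "contains_pattern w [a, b, c] \<longleftrightarrow>
     (\<exists>i j k. i < j \<and> j < k \<and> k < length w \<and>
        (w ! i \<le> w ! j \<longleftrightarrow> a \<le> b) \<and> (w ! j \<le> w ! i \<longleftrightarrow> b \<le> a) \<and>
        (w ! i \<le> w ! k \<longleftrightarrow> a \<le> c) \<and> (w ! k \<le> w ! i \<longleftrightarrow> c \<le> a) \<and>
        (w ! j \<le> w ! k \<longleftrightarrow> b \<le> c) \<and> (w ! k \<le> w ! j \<longleftrightarrow> c \<le> b))"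
    (is "?L \<longleftrightarrow> ?R")
proof -
  have all3: "(\<forall>x<3. P x) \<longleftrightarrow> P 0 \<and> P (Suc 0) \<and> P (Suc (Suc 0))" for P :: "nat \<Rightarrow> bool"
    by (auto simp: numeral_3_eq_3 less_Suc_eq)
  show ?thesis
  proof
    assume ?L
    then obtain f where mono: "strict_mono_on {..<3::nat} f" and len: "\<forall>x<3. f x < length w"
      and ord: "\<forall>x<3. \<forall>y<3. w ! f x \<le> w ! f y \<longleftrightarrow> [a, b, c] ! x \<le> [a, b, c] ! y"
      unfolding contains_pattern_def by (auto simp: numeral_3_eq_3)
    have "f 0 < f (Suc 0)" "f (Suc 0) < f (Suc (Suc 0))"
      using mono by (auto simp: strict_mono_on_def)
    then show ?R
      using len ord unfolding all3
      by (intro exI[of _ "f 0"] exI[of _ "f (Suc 0)"] exI[of _ "f (Suc (Suc 0))"]) simp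
  next
    assume ?R
    then obtain i j k where ijk: "i < j" "j < k" "k < length w" and
      ord: "w ! i \<le> w ! j \<longleftrightarrow> a \<le> b" "w ! j \<le> w ! i \<longleftrightarrow> b \<le> a"
        "w ! i \<le> w ! k \<longleftrightarrow> a \<le> c" "w ! k \<le> w ! i \<longleftrightarrow> c \<le> a"
        "w ! j \<le> w ! k \<longleftrightarrow> b \<le> c" "w ! k \<le> w ! j \<longleftrightarrow> c \<le> b"
      by blast
    have three: "length [a, b, c] = 3" by simp
    let ?f = "(!) [i, j, k]"
    have "strict_mono_on {..<3} ?f"
      using ijk by (auto simp: strict_mono_on_def numeral_3_eq_3 less_Suc_eq)
    then show ?L
      unfolding contains_pattern_def three all3
      using ijk ord by (intro exI[of _ ?f]) auto
  qed
qed

text \<open>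
  The three patterns are exactly those of size 3 whose first entry is below the last one.
\<close>

lemma avoids_iff_far_decreasing:
  assumes "distinct w"
  shows "(\<forall>\<rho>\<in>{[1,2,3], [1,3,2], [2,1,3]}. avoids_pattern w \<rho>) \<longleftrightarrow> far_decreasing w"
proof
  assume av: "\<forall>\<rho>\<in>{[1,2,3], [1,3,2], [2,1,3]}. avoids_pattern w \<rho>"
  show "far_decreasing w"
    unfolding far_decreasing_def
  proof (intro allI impI, rule ccontr)
    fix i k assume ik: "i + 2 \<le> k \<and> k < length w" and "\<not> w ! k < w ! i"
    \<comment> \<open>The entry at \<open>Suc i\<close> lies strictly between the two positions;
      each possible rank of it yields one of the three patterns.\<close>
    moreover have "w ! i \<noteq> w ! k" "w ! i \<noteq> w ! Suc i" "w ! Suc i \<noteq> w ! k"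
      using ik assms by (auto simp: nth_eq_iff_index_eq)
    ultimately have "w ! i < w ! Suc i \<and> w ! Suc i < w ! k \<or>
        w ! i < w ! k \<and> w ! k < w ! Suc i \<or> w ! Suc i < w ! i \<and> w ! i < w ! k"
      by linarith
    then have "contains_pattern w [1,2,3] \<or> contains_pattern w [1,3,2] \<or> contains_pattern w [2,1,3]"
    proof (elim disjE)
      assume "w ! i < w ! Suc i \<and> w ! Suc i < w ! k"
      then have "contains_pattern w [1,2,3]"
        unfolding contains_pattern3 using ik
        by (intro exI[of _ i] exI[of _ "Suc i"] exI[of _ k]) auto
      then show ?thesis by blast
    next
      assume "w ! i < w ! k \<and> w ! k < w ! Suc i"
      then have "contains_pattern w [1,3,2]"
        unfolding contains_pattern3 using ik
        by (intro exI[of _ i] exI[of _ "Suc i"] exI[of _ k]) auto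
      then show ?thesis by blast
    next
      assume "w ! Suc i < w ! i \<and> w ! i < w ! k"
      then have "contains_pattern w [2,1,3]"
        unfolding contains_pattern3 using ik
        by (intro exI[of _ i] exI[of _ "Suc i"] exI[of _ k]) auto
      then show ?thesis by blast
    qed
    with av show False
      unfolding avoids_pattern_def by blast
  qed
next
  assume fd: "far_decreasing w"
  have "\<not> (\<exists>i j k. i < j \<and> j < k \<and> k < length w \<and> w ! i \<le> w ! k)"
  proof (intro notI, elim exE)
    fix i j k assume "i < j \<and> j < k \<and> k < length w \<and> w ! i \<le> w ! k"
    then show False
      using fd[unfolded far_decreasing_def, rule_format, of i k] by simp
  qed
  then show "\<forall>\<rho>\<in>{[1,2,3], [1,3,2], [2,1,3]}. avoids_pattern w \<rho>"
    unfolding avoids_pattern_def by (auto simp: contains_pattern3)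
qed

section \<open>Dyck paths with a starting height\<close>

fun dyck_from :: "nat \<Rightarrow> step list \<Rightarrow> bool" where
  "dyck_from h [] \<longleftrightarrow> h = 0"
| "dyck_from h (North # d) \<longleftrightarrow> dyck_from (Suc h) d"
| "dyck_from h (East # d) \<longleftrightarrow> 0 < h \<and> dyck_from (h - 1) d"

lemma dyck_from_iff:
  "dyck_from h d \<longleftrightarrow> count_list d East = h + count_list d North \<and>
     (\<forall>k\<le>length d. count_list (take k d) East \<le> h + count_list (take k d) North)"
proof (induction d arbitrary: h)
  case Nil
  then show ?case by auto
next
  case (Cons s d)
  have split: "(\<forall>k\<le>Suc m. P k) \<longleftrightarrow> P 0 \<and> (\<forall>k\<le>m. P (Suc k))" for P and m :: nat
    by (simp only: less_Suc_eq_le[symmetric] All_less_Suc2)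
  show ?case
  proof (cases s)
    case North
    then show ?thesis by (simp add: split Cons.IH)
  next
    case East
    show ?thesis
    proof (cases h)
      case 0
      \<comment> \<open>An east step at height 0 already violates the condition on the prefix of
        length 1.\<close>
      have "\<not> count_list (take 1 (s # d)) East \<le> h + count_list (take 1 (s # d)) North"
        using East 0 by simp
      then show ?thesis using East 0 by (auto simp: split)
    next
      case (Suc h')
      then show ?thesis using East by (simp add: split Cons.IH)
    qed
  qed
qed

lemma dyck_path_iff: "dyck_path n d \<longleftrightarrow> dyck_from 0 d \<and> count_list d North = n"
  unfolding dyck_path_def dyck_from_iff add_0 by blast

lemma dyck_from_replicate_East:
  "dyck_from h (replicate k East @ d) \<longleftrightarrow> k \<le> h \<and> dyck_from (h - k) d"
proof (induction k arbitrary: h)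
  case (Suc k)
  then show ?case by (cases h) simp_all
qed simp

lemma not_dyck_from_snoc_North: "\<not> dyck_from h (d @ [North])"
  by (induction h d rule: dyck_from.induct) auto

section \<open>Labels along a path\<close>

lemma count_North_unlabel: "count_list (map unlabel p) North = length (reading_word p)"
  by (induction p rule: reading_word.induct) auto

lemma reading_word_append: "reading_word (p @ q) = reading_word p @ reading_word q"
  by (induction p rule: reading_word.induct) auto

lemma reading_word_replicate [simp]: "reading_word (replicate k LEast) = []"
  by (induction k) auto

lemma length_perm: "is_perm n w \<Longrightarrow> length w = n"
  unfolding is_perm_def by (metis card_atLeastAtMost diff_Suc_1 distinct_card)

lemma is_perm_Cons_max: "is_perm (Suc n) (Suc n # w) \<longleftrightarrow> is_perm n w"
proof -
  have "{1..Suc n} = insert (Suc n) {1..n}" by (simp add: atLeastAtMostSuc_conv)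
  then have "set (Suc n # w) = {1..Suc n} \<longleftrightarrow> set w = {1..n}" if "Suc n \<notin> set w"
    using insert_ident[of "Suc n" "set w" "{1..n}"] that by simp
  moreover have "Suc n \<notin> set w" if "set w = {1..n}"
    using that by simp
  ultimately show ?thesis
    unfolding is_perm_def distinct.simps(2) by blast
qed

lemma is_perm_swap: "is_perm n (a # b # w) \<longleftrightarrow> is_perm n (b # a # w)"
proof -
  have "set (a # b # w) = set (b # a # w)" by auto
  moreover have "distinct (a # b # w) \<longleftrightarrow> distinct (b # a # w)" by auto
  ultimately show ?thesis unfolding is_perm_def by metis
qed

text \<open>Stating the label condition for neighbouring steps lets \<open>successively\<close>
  treat it recursively.\<close>

definition ascent :: "labelled_step \<Rightarrow> labelled_step \<Rightarrow> bool" where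
  "ascent x y \<longleftrightarrow> (\<forall>a b. x = LNorth a \<and> y = LNorth b \<longrightarrow> a < b)"

lemma ascent_simps [simp]:
  "ascent LEast y" "ascent x LEast" "ascent (LNorth a) (LNorth b) \<longleftrightarrow> a < b"
  by (auto simp: ascent_def)

lemma successively_ascent_LEast [simp]:
  "successively ascent (LEast # p) \<longleftrightarrow> successively ascent p"
  by (cases p) auto

lemma successively_ascent_replicate [simp]:
  "successively ascent (replicate k LEast @ p) \<longleftrightarrow> successively ascent p"
  by (induction k) auto

text \<open>
  The suffixes of the parking functions in question, from height \<open>h\<close> on: the labels read
  so far are always the largest ones whenever a block is complete.
\<close>

definition parking_suffix :: "nat \<Rightarrow> nat \<Rightarrow> labelled_step list \<Rightarrow> bool" where
  "parking_suffix n h p \<longleftrightarrow>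
     dyck_from h (map unlabel p) \<and> is_perm n (reading_word p) \<and>
     far_decreasing (reading_word p) \<and> successively ascent p"

lemma parking_avoiding_iff:
  "parking_function n p \<and> (\<forall>\<rho>\<in>{[1,2,3], [1,3,2], [2,1,3]}. avoids_pattern (reading_word p) \<rho>)
     \<longleftrightarrow> parking_suffix n 0 p"
proof -
  have "successively ascent p \<longleftrightarrow>
      (\<forall>i a b. Suc i < length p \<and> p ! i = LNorth a \<and> p ! Suc i = LNorth b \<longrightarrow> a < b)"
    by (auto simp: successively_conv_nth ascent_def)
  moreover have "is_perm n (reading_word p) \<Longrightarrow>
      (\<forall>\<rho>\<in>{[1,2,3], [1,3,2], [2,1,3]}. avoids_pattern (reading_word p) \<rho>)
        \<longleftrightarrow> far_decreasing (reading_word p)"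
    using avoids_iff_far_decreasing unfolding is_perm_def by blast
  moreover have "is_perm n (reading_word p) \<Longrightarrow> count_list (map unlabel p) North = n"
    by (simp add: count_North_unlabel length_perm)
  ultimately show ?thesis
    unfolding parking_function_def parking_suffix_def dyck_path_iff by blast
qed

text \<open>The largest label in front exceeds all later ones, so it adds no condition on the
  labels; the height becomes \<open>Suc h - Suc k\<close>.\<close>

lemma parking_suffix_Single:
  "parking_suffix (Suc n) h (LNorth (Suc n) # replicate (Suc k) LEast @ p) \<longleftrightarrow>
     k \<le> h \<and> parking_suffix n (h - k) p"
proof -
  have "is_perm n w \<Longrightarrow> \<forall>x\<in>set w. x < Suc n" for w
    by (auto simp: is_perm_def)
  then have less: "is_perm n w \<Longrightarrow> \<forall>x\<in>set (tl w). x < Suc n" for w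
    by (metis list.sel(2) list.set_sel(2))
  show ?thesis
    using less[of "reading_word p"] unfolding parking_suffix_def
    by (auto simp: dyck_from_replicate_East reading_word_append is_perm_Cons_max)
qed

lemma parking_suffix_Double:
  "parking_suffix (Suc (Suc n)) h
     (LNorth (Suc n) # replicate j LEast @ LNorth (Suc (Suc n)) # replicate (Suc k) LEast @ p)
   \<longleftrightarrow> j + k \<le> Suc h \<and> parking_suffix n (Suc h - (j + k)) p"
proof -
  have perm: "is_perm (Suc (Suc n)) (Suc n # Suc (Suc n) # w) \<longleftrightarrow> is_perm n w" for w
    by (subst is_perm_swap) (simp add: is_perm_Cons_max)
  have less: "is_perm n w \<Longrightarrow> \<forall>x\<in>set w. x < Suc n" for w
    by (auto simp: is_perm_def)
  then have less': "is_perm n w \<Longrightarrow> \<forall>x\<in>set (tl w). x < Suc (Suc n)" for w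
    by (metis less_SucI list.sel(2) list.set_sel(2))
  have dyck: "j \<le> Suc h \<and> Suc k \<le> Suc (Suc h - j) \<and> dyck_from (Suc (Suc h - j) - Suc k) d \<longleftrightarrow>
      j + k \<le> Suc h \<and> dyck_from (Suc h - (j + k)) d" for d
    by auto
  \<comment> \<open>For \<open>j = 0\<close> the two north steps are consecutive and their labels
    increase; otherwise east steps separate them.\<close>
  have asc: "successively ascent (LNorth (Suc n) # replicate j LEast @
      LNorth (Suc (Suc n)) # replicate (Suc k) LEast @ p) \<longleftrightarrow> successively ascent p"
    by (cases j) simp_all
  show ?thesis
    using less[of "reading_word p"] less'[of "reading_word p"] dyck[of "map unlabel p"]
    unfolding parking_suffix_def asc
    by (auto simp: dyck_from_replicate_East reading_word_append perm simp del: replicate_Suc)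
qed

fun path_of :: "nat \<Rightarrow> block list \<Rightarrow> labelled_step list" where
  "path_of n [] = []"
| "path_of n (Single k # v) = LNorth n # replicate (Suc k) LEast @ path_of (n - 1) v"
| "path_of n (Double j k # v) =
     LNorth (n - 1) # replicate j LEast @ LNorth n # replicate (Suc k) LEast @ path_of (n - 2) v"

lemma parking_suffix_path_of:
  "parking_suffix (word_size v) h (path_of (word_size v) v) \<longleftrightarrow> descends_from h v"
proof (induction v arbitrary: h)
  case Nil
  then show ?case by (simp add: parking_suffix_def is_perm_def)
next
  case (Cons b v)
  then show ?case
    by (cases b) (simp_all add: parking_suffix_Single parking_suffix_Double del: replicate_Suc)
qed

section \<open>Unique cutting of a path into blocks\<close>

definition north_first :: "labelled_step list \<Rightarrow> bool" where
  "north_first p \<longleftrightarrow> (\<forall>q. p \<noteq> LEast # q)"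

lemma north_first_path_of: "north_first (path_of n v)"
  by (cases "(n, v)" rule: path_of.cases) (auto simp: north_first_def)

lemma replicate_LEast_unique:
  assumes "replicate k LEast @ p = replicate l LEast @ q" "north_first p" "north_first q"
  shows "k = l \<and> p = q"
  using assms
proof (induction k arbitrary: l)
  case 0
  then show ?case by (cases l) (auto simp: north_first_def)
next
  case (Suc k)
  then show ?case by (cases l) (auto simp: north_first_def)
qed

lemma replicate_LEast_split: "\<exists>k q. p = replicate k LEast @ q \<and> north_first q"
proof (induction p)
  case Nil
  then show ?case by (auto simp: north_first_def)
next
  case (Cons s p)
  then obtain k q where kq: "p = replicate k LEast @ q" "north_first q" by blast
  show ?case
  proof (cases s)
    case (LNorth a)
    then show ?thesis
      by (intro exI[of _ 0] exI[of _ "s # p"]) (auto simp: north_first_def)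
  next
    case LEast
    then show ?thesis
      using kq by (intro exI[of _ "Suc k"] exI[of _ q]) auto
  qed
qed

text \<open>With \<open>n\<close> the common size, the first label is \<open>n\<close> for a
  \<open>Single\<close> and \<open>n - 1\<close> for a \<open>Double\<close>; the arguments are
  lengths of maximal runs of east steps.\<close>

lemma path_of_inj:
  "path_of (word_size u) u = path_of (word_size v) v \<Longrightarrow> word_size u = word_size v \<Longrightarrow> u = v"
proof (induction u arbitrary: v)
  case Nil
  show ?case
  proof (cases v)
    case (Cons c w)
    with Nil.prems show ?thesis by (cases c) auto
  qed simp
next
  case (Cons b u)
  have nf: "north_first (LNorth a # p)" for a p
    by (simp add: north_first_def)
  show ?case
  proof (cases v)
    case Nil
    with Cons.prems show ?thesis by (cases b) auto
  next
    case v: (Cons c w)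
    show ?thesis
    proof (cases b; cases c)
      fix k l assume bc: "b = Single k" "c = Single l"
      have size: "word_size u = word_size w" using Cons.prems(2) v bc by simp
      have "replicate (Suc k) LEast @ path_of (word_size u) u
          = replicate (Suc l) LEast @ path_of (word_size w) w"
        using Cons.prems v bc size by simp
      from replicate_LEast_unique[OF this north_first_path_of north_first_path_of]
      show ?thesis using Cons.IH[of w] v bc size by simp
    next
      fix k i l assume "b = Single k" "c = Double i l"
      then show ?thesis using Cons.prems v by simp
    next
      fix i j k assume "b = Double i j" "c = Single k"
      then show ?thesis using Cons.prems v by simp
    next
      fix i k j l assume bc: "b = Double i k" "c = Double j l"
      have size: "word_size u = word_size w" using Cons.prems(2) v bc by simp
      have "replicate i LEast @ LNorth (word_size u + 2) # replicate (Suc k) LEast @ path_of (word_size u) u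
          = replicate j LEast @ LNorth (word_size u + 2) # replicate (Suc l) LEast @ path_of (word_size w) w"
        using Cons.prems v bc size by simp
      from replicate_LEast_unique[OF this nf nf] have "i = j"
        and *: "replicate (Suc k) LEast @ path_of (word_size u) u
          = replicate (Suc l) LEast @ path_of (word_size w) w"
        by simp_all
      from replicate_LEast_unique[OF *(1) north_first_path_of north_first_path_of]
      show ?thesis using Cons.IH[of w] v bc size \<open>i = j\<close> by simp
    qed
  qed
qed

text \<open>The path cannot end right after the label \<open>n\<close>, as it ends at height 0, and
  a north step there would need a larger label. So an east step follows.\<close>

lemma parking_suffix_after_max:
  assumes "parking_suffix n h (p @ LNorth n # q)"
  obtains k r where "q = replicate (Suc k) LEast @ r" "north_first r"
proof -
  obtain k r where kr: "q = replicate k LEast @ r" "north_first r"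
    using replicate_LEast_split by blast
  have "k \<noteq> 0"
  proof
    assume "k = 0"
    then have q: "q = r" by (simp add: kr)
    show False
    proof (cases r)
      case Nil
      then show False
        using assms not_dyck_from_snoc_North q by (auto simp: parking_suffix_def)
    next
      case (Cons s r')
      then obtain b where s: "s = LNorth b"
        using kr by (cases s) (auto simp: north_first_def)
      have "b \<in> {1..n}" and "n < b"
        using assms q Cons s
        by (auto simp: parking_suffix_def reading_word_append is_perm_def successively_append_iff)
      then show False by simp
    qed
  qed
  then obtain l where "k = Suc l"
    using not0_implies_Suc by blast
  then show thesis
    using that[of l r] kr by simp
qed

text \<open>Blocks are peeled off the front: \<open>n\<close> is the first or the second label,
  which gives a \<open>Single\<close> or a \<open>Double\<close>.\<close>

lemma parking_suffix_imp_path_of: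
  "parking_suffix n h p \<Longrightarrow> north_first p \<Longrightarrow> \<exists>v. word_size v = n \<and> p = path_of n v"
proof (induction "length p" arbitrary: n h p rule: less_induct)
  case less
  show ?case
  proof (cases p)
    case Nil
    then have "word_size [] = n \<and> p = path_of n []"
      using less.prems by (auto simp: parking_suffix_def is_perm_def)
    then show ?thesis ..
  next
    case (Cons s q)
    then obtain a where p: "p = LNorth a # q"
      using less.prems by (cases s) (auto simp: north_first_def)
    have perm: "is_perm n (a # reading_word q)"
      and far: "\<forall>x\<in>set (tl (reading_word q)). x < a"
      using less.prems by (auto simp: p parking_suffix_def)
    then have a: "a \<in> {1..n}" by (auto simp: is_perm_def)
    show ?thesis
    proof (cases "a = n")
      case True
      have "parking_suffix n h ([] @ LNorth n # q)"
        using less.prems p True by simp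
      then obtain k r where q: "q = replicate (Suc k) LEast @ r" "north_first r"
        by (rule parking_suffix_after_max)
      obtain m where n: "n = Suc m" using a by (cases n) auto
      have "parking_suffix m (h - k) r"
        using less.prems(1) unfolding p True q(1) n parking_suffix_Single by simp
      moreover have "length r < length p"
        by (simp add: p q(1))
      ultimately obtain v where "word_size v = m" "r = path_of m v"
        using less.hyps q(2) by blast
      then have "word_size (Single k # v) = n \<and> p = path_of n (Single k # v)"
        using p q(1) True n by simp
      then show ?thesis ..
    next
      case False
      obtain j r where q: "q = replicate j LEast @ r" "north_first r"
        using replicate_LEast_split by blast
      have rq: "reading_word q = reading_word r"
        by (simp add: q reading_word_append)
      have "n \<in> set (reading_word r)"
        using perm False a by (auto simp: is_perm_def rq)
      \<comment> \<open>Labels from the third on are below \<open>a\<close>, hence below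
        \<open>n\<close>.\<close>
      moreover have "n \<notin> set (tl (reading_word r))"
        using far a by (auto simp: rq)
      ultimately obtain w where w: "reading_word r = n # w"
        by (cases "reading_word r") auto
      then obtain r' where r: "r = LNorth n # r'"
        using q(2) by (cases r rule: reading_word.cases) (auto simp: north_first_def)
      \<comment> \<open>Otherwise \<open>n - 1\<close> would come third or later and be below
        \<open>a\<close>, forcing \<open>a = n\<close>.\<close>
      have "a = n - 1"
      proof (rule ccontr)
        assume "a \<noteq> n - 1"
        then have "n - 1 \<in> {1..n}" and ne: "n - 1 \<noteq> a" "n - 1 \<noteq> n"
          using a False by auto
        moreover have "insert a (insert n (set w)) = {1..n}"
          using perm by (simp add: is_perm_def rq w)
        ultimately have "n - 1 \<in> set w"
          by (metis insert_iff)
        then have "n - 1 < a" using far by (simp add: rq w)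
        then show False using a False by auto
      qed
      moreover have "2 \<le> n"
        using a False by simp
      ultimately obtain m where n: "n = Suc (Suc m)" and am: "a = Suc m"
        using that[of "n - 2"] by simp
      have "parking_suffix n h ((LNorth a # replicate j LEast) @ LNorth n # r')"
        using less.prems p q(1) r by simp
      then obtain k t where t: "r' = replicate (Suc k) LEast @ t" "north_first t"
        by (rule parking_suffix_after_max)
      have "parking_suffix m (Suc h - (j + k)) t"
        using less.prems(1) unfolding p q(1) r t(1) n am parking_suffix_Double by simp
      moreover have "length t < length p"
        by (simp add: p q(1) r t(1))
      ultimately obtain v where "word_size v = m" "t = path_of m v"
        using less.hyps t(2) by blast
      then have "word_size (Double j k # v) = n \<and> p = path_of n (Double j k # v)"
        using p q(1) r t(1) n am by simp
      then show ?thesis ..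
    qed
  qed
qed

lemma bij_betw_words_parking:
  "bij_betw (path_of n) {v. descends_from 0 v \<and> word_size v = n} {p. parking_suffix n 0 p}"
proof (rule bij_betw_imageI)
  show "inj_on (path_of n) {v. descends_from 0 v \<and> word_size v = n}"
    by (rule inj_onI, rule path_of_inj) auto
  \<comment> \<open>A path starting at height 0 cannot begin with an east step.\<close>
  have "north_first p" if "parking_suffix n 0 p" for p
    using that by (auto simp: parking_suffix_def north_first_def)
  then show "path_of n ` {v. descends_from 0 v \<and> word_size v = n} = {p. parking_suffix n 0 p}"
    using parking_suffix_path_of parking_suffix_imp_path_of by blast
qed

theorem theorem11:
  fixes n :: nat
  assumes "n \<ge> 1"
  shows "pf n {[1,2,3], [1,3,2], [2,1,3]} =
    card {t :: plane_tree. card (edges t) = n + 1 \<and>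
      (\<forall>v. is_vertex t v \<longrightarrow> is_leaf t v \<or> (\<exists>u. is_leaf t u \<and> adjacent t v u))}"
proof -
  have "pf n {[1,2,3], [1,3,2], [2,1,3]} = card {p. parking_suffix n 0 p}"
    unfolding pf_def parking_avoiding_iff ..
  also have "\<dots> = card {v. descends_from 0 v \<and> word_size v = n}"
    using bij_betw_same_card[OF bij_betw_words_parking] by simp
  also have "\<dots> = card {t. leafy t \<and> num_vertices t = n + 2}"
    by (rule bij_betw_same_card[OF bij_betw_words_trees])
  \<comment> \<open>\<open>n + 1\<close> edges amount to \<open>n + 2\<close> vertices by
    \<open>card_edges\<close>.\<close>
  also have "{t. leafy t \<and> num_vertices t = n + 2} =
      {t. card (edges t) = n + 1 \<and>
        (\<forall>v. is_vertex t v \<longrightarrow> is_leaf t v \<or> (\<exists>u. is_leaf t u \<and> adjacent t v u))}"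
    unfolding leafy_iff[symmetric] card_edges[symmetric] by auto
  finally show ?thesis .
qed

end
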